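(* Let $I\subset\mathbb{R}$ and $\varepsilon_0\in I$. For every $\varepsilon\in I$ let $\mathcal{D}_\varepsilon$ be a collection of families of nonempty subsets of $X$ and let $\varphi_\varepsilon$ be a continuous cocycle on $X$ over $\mathbb{R}$ and $(\Omega,\mathcal{F},P,\{\vartheta_t\}_{t\in\mathbb{R}})$. Consider the following conditions. (C1) For every $t\in\mathbb{R}^+$, $\tau\in\mathbb{R}$, $\omega\in\Omega$, every sequence $\varepsilon_n\in I$ with $\varepsilon_n\to\varepsilon_0$, and $x_n,x\in X$ with $x_n\to x$ in $X$, $$\lim_{n\to\infty}\varphi_{\varepsilon_n}(t,\tau-t,\vartheta_{-t}\omega,x_n)=\varphi_{\varepsilon_0}(t,\tau-t,\vartheta_{-t}\omega,x)\quad\text{in }X.$$ (C2) There is a map $R_{\varepsilon_0}:\mathbb{R}\times\Omega\to\mathbb{R}^+$ such that the family $B_0=\{B_0(\tau,\omega)=\{x\in X:\|x\|_X\le R_{\varepsilon_0}(\tau,\omega)\};\tau\in\mathbb{R},\omega\in\Omega\}$ belongs to $\mathcal{D}_{\varepsilon_0}$. (C3) For every $\varepsilon\in I$, $\varphi_\varepsilon$ has a $\mathcal{D}_\varepsilon$-pullback attractor $\mathcal{A}_\varepsilon\in\mathcal{D}_\varepsilon$ in $X\cap Y$ (i.e. $\mathcal{A}_\varepsilon$ is a $\mathcal{D}_\varepsilon$-pullback attractor both in $X$ and in $Y$) and a closed and measurable $\mathcal{D}_\varepsilon$-pullback absorbing set $K_\varepsilon\in\mathcal{D}_\varepsilon$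 in $X$ such that for every $\tau\in\mathbb{R}$, $\omega\in\Omega$, $$\limsup_{\varepsilon\to\varepsilon_0}\|K_\varepsilon(\tau,\omega)\|_X\le R_{\varepsilon_0}(\tau,\omega).$$ (C4) For every $\tau\in\mathbb{R}$, $\omega\in\Omega$, $\bigcup_{\varepsilon\in I}\mathcal{A}_\varepsilon(\tau,\omega)$ is precompact in $X$. (C5) For every $\tau\in\mathbb{R}$, $\omega\in\Omega$, $\bigcup_{\varepsilon\in I}\mathcal{A}_\varepsilon(\tau,\omega)$ is precompact in $Y$. If (C1)–(C4) hold, then for each $\tau\in\mathbb{R}$, $\omega\in\Omega$, $$\lim_{\varepsilon\to\varepsilon_0}\mathrm{dist}_X(\mathcal{A}_\varepsilon(\tau,\omega),\mathcal{A}_{\varepsilon_0}(\tau,\omega))=0.$$ If further (C1)–(C5) hold together with (a) for every $\varepsilon\in I$, $t>0$, $\tau\in\mathbb{R}$, $\omega\in\Omega$, the map $\varphi_\varepsilon(t,\tau,\omega,\cdot)$ sends $X$ into $X\cap Y$, and (b) if $\{x_n\}_n\subset X\cap Y$ satisfies $x_n\to x$ in $X$ and $x_n\to y$ in $Y$, then $x=y$, then for each $\tau\in\mathbb{R}$, $\omega\in\Omega$, $$\lim_{\varepsilon\to\varepsilon_0}\mathrm{dist}_Y(\mathcal{A}_\varepsilon(\tau,\omega),\mathcal{A}_{\varepsilon_0}(\tau,\omega))=0.$$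
   Context: $(X,\|\cdot\|_X)$ and $(Y,\|\cdot\|_Y)$ are complete separable Banach spaces with $X\cap Y\neq\emptyset$; no inclusion between them is assumed. $\mathbb{R}^+=[0,\infty)$. For $S\subset X$, $\|S\|_X=\sup_{x\in S}\|x\|_X$. $(\Omega,\mathcal{F},P,\{\vartheta_t\}_{t\in\mathbb{R}})$ is a measurable dynamical system: a probability space with a (jointly measurable) group $\vartheta_t$ of measure preserving transformations. Cocycle: a family of measurable mappings $\varphi:\mathbb{R}^+\times\mathbb{R}\times\Omega\times X\to X$ (i.e. $\varphi(\cdot,\tau,\cdot,\cdot)$ is $(\mathcal{B}(\mathbb{R}^+)\times\mathcal{F}\times\mathcal{B}(X),\mathcal{B}(X))$-measurable for each $\tau$) such that for all $\tau,\omega$, $t,s\in\mathbb{R}^+$: $\varphi(0,\tau,\omega,\cdot)$ is the identity on $X$, and $\varphi(t+s,\tau,\omega,\cdot)=\varphi(t,\tau+s,\vartheta_s\omega,\cdot)\circ\varphi(s,\tau,\omega,\cdot)$. It is continuous if each $\varphi(t,\tau,\omega,\cdot):X\to X$ is continuous. Let $\mathcal{D}$ be a collection of families $B=\{B(\tau,\omega);\tau\in\mathbb{R},\omega\in\Omega\}$ of nonempty subsets of $X$. $\mathrm{dist}_X(A,B)=\sup_{a\in A}\inf_{b\in B}\|a-b\|_X$ is the Hausdorff semi-metric (similarly $\mathrm{dist}_Y$). A family $K$ is measurable in $X$ if $\omega\mapsto\mathrm{dist}_X(x,K(\tau,\omega))$ is measurable w.r.t. the $P$-completion of $\mathcal{F}$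 for every $x\in X$, $\tau\in\mathbb{R}$; it is closed if each $K(\tau,\omega)$ is closed and nonempty in $X$. $K\in\mathcal{D}$ is a $\mathcal{D}$-pullback absorbing set for $\varphi$ in $X$ if for all $\tau,\omega$ and $B\in\mathcal{D}$ there is $T=T(\tau,\omega,B)>0$ with $\varphi(t,\tau-t,\vartheta_{-t}\omega,B(\tau-t,\vartheta_{-t}\omega))\subseteq K(\tau,\omega)$ for all $t\ge T$. $\mathcal{A}\in\mathcal{D}$ is a $\mathcal{D}$-pullback attractor for $\varphi$ in $X$ (resp. in $Y$) if (1) $\mathcal{A}$ is measurable in $X$ w.r.t. the $P$-completion of $\mathcal{F}$ and each $\mathcal{A}(\tau,\omega)$ is compact in $X$ (resp. $Y$); (2) $\varphi(t,\tau,\omega,\mathcal{A}(\tau,\omega))=\mathcal{A}(\tau+t,\vartheta_t\omega)$ for all $t\ge0,\tau,\omega$; (3) for every $B\in\mathcal{D}$ and all $\tau,\omega$, $\lim_{t\to\infty}\mathrm{dist}_X(\varphi(t,\tau-t,\vartheta_{-t}\omega,B(\tau-t,\vartheta_{-t}\omega)),\mathcal{A}(\tau,\omega))=0$ (resp. with $\mathrm{dist}_Y$). *)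

theory Defs
  imports "HOL-Probability.Probability"
begin

text \<open>The index set \<open>\<Omega>\<close> of the probability space is \<^term>\<open>space M\<close>, so all conditions on sample
  points are relativised to it.\<close>

definition measurable_dynamical_system ::
  "'w measure \<Rightarrow> (real \<Rightarrow> 'w \<Rightarrow> 'w) \<Rightarrow> bool" where
  "measurable_dynamical_system M \<theta> \<longleftrightarrow>
     prob_space M \<and>
     (\<lambda>(t, \<omega>). \<theta> t \<omega>) \<in> borel \<Otimes>\<^sub>M M \<rightarrow>\<^sub>M M \<and>
     (\<forall>\<omega>\<in>space M. \<theta> 0 \<omega> = \<omega>) \<and>
     (\<forall>s t. \<forall>\<omega>\<in>space M. \<theta> (s + t) \<omega> = \<theta> s (\<theta> t \<omega>)) \<and>
     (\<forall>t. distr M M (\<theta> t) = M)"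

definition cocycle ::
  "'w measure \<Rightarrow> (real \<Rightarrow> 'w \<Rightarrow> 'w) \<Rightarrow>
   (real \<Rightarrow> real \<Rightarrow> 'w \<Rightarrow> 'x::{banach, second_countable_topology} \<Rightarrow> 'x) \<Rightarrow> bool" where
  "cocycle M \<theta> \<phi> \<longleftrightarrow>
     (\<forall>\<tau>. (\<lambda>(t, \<omega>, x). \<phi> t \<tau> \<omega> x)
            \<in> restrict_space borel {0..} \<Otimes>\<^sub>M (M \<Otimes>\<^sub>M borel) \<rightarrow>\<^sub>M borel) \<and>
     (\<forall>\<tau>. \<forall>\<omega>\<in>space M. \<phi> 0 \<tau> \<omega> = id) \<and>
     (\<forall>\<tau>. \<forall>\<omega>\<in>space M. \<forall>t\<ge>0. \<forall>s\<ge>0.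
        \<phi> (t + s) \<tau> \<omega> = \<phi> t (\<tau> + s) (\<theta> s \<omega>) \<circ> \<phi> s \<tau> \<omega>)"

definition continuous_cocycle ::
  "'w measure \<Rightarrow> (real \<Rightarrow> 'w \<Rightarrow> 'w) \<Rightarrow>
   (real \<Rightarrow> real \<Rightarrow> 'w \<Rightarrow> 'x::{banach, second_countable_topology} \<Rightarrow> 'x) \<Rightarrow> bool" where
  "continuous_cocycle M \<theta> \<phi> \<longleftrightarrow>
     cocycle M \<theta> \<phi> \<and>
     (\<forall>t\<ge>0. \<forall>\<tau>. \<forall>\<omega>\<in>space M. continuous_on UNIV (\<phi> t \<tau> \<omega>))"

type_synonym ('w, 'x) family = "real \<Rightarrow> 'w \<Rightarrow> 'x set"

text \<open>A family indexed by \<open>\<real> \<times> \<Omega>\<close> is an extensional function in the second argument, so that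
  membership in a collection does not depend on arbitrary values outside \<^term>\<open>space M\<close>.\<close>

definition family_collection :: "'w measure \<Rightarrow> ('w, 'x) family set \<Rightarrow> bool" where
  "family_collection M \<D> \<longleftrightarrow> (\<forall>B\<in>\<D>. \<forall>\<tau>. B \<tau> \<in> (\<Pi>\<^sub>E \<omega>\<in>space M. {S. S \<noteq> {}}))"

definition measurable_family ::
  "'w measure \<Rightarrow> ('w, 'x::{banach, second_countable_topology}) family \<Rightarrow> bool" where
  "measurable_family M K \<longleftrightarrow>
     (\<forall>x \<tau>. (\<lambda>\<omega>. infdist x (K \<tau> \<omega>)) \<in> borel_measurable (completion M))"

definition closed_family ::
  "'w measure \<Rightarrow> ('w, 'x::{banach, second_countable_topology}) family \<Rightarrow> bool" where
  "closed_family M K \<longleftrightarrow> (\<forall>\<tau>. \<forall>\<omega>\<in>space M. closed (K \<tau> \<omega>) \<and> K \<tau> \<omega> \<noteq> {})"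

text \<open>Extended values are needed for both suprema: members of a collection may be unbounded.\<close>

definition set_norm :: "'v::real_normed_vector set \<Rightarrow> ennreal" where
  "set_norm S = (SUP x\<in>S. ennreal (norm x))"

definition semidist :: "'v::real_normed_vector set \<Rightarrow> 'v set \<Rightarrow> ennreal" where
  "semidist A B = (SUP a\<in>A. INF b\<in>B. ennreal (norm (a - b)))"

text \<open>The two Banach spaces are types \<open>'x\<close> and \<open>'y\<close>, injected by \<open>iX\<close> and \<open>iY\<close> into a common
  type \<open>'z\<close>; the intersection of the spaces is \<^term>\<open>range iX \<inter> range iY\<close>. The injections carry no
  further structure: the norms and topologies are unrelated. The next constant is the part of a
  subset of the first space that lies in the second, as a subset of the second.\<close>

definition part_in :: "('x \<Rightarrow> 'z) \<Rightarrow> ('y \<Rightarrow> 'z) \<Rightarrow> 'x set \<Rightarrow> 'y set" where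
  "part_in iX iY S = iY -` (iX ` S)"

definition compact_in ::
  "('x \<Rightarrow> 'z) \<Rightarrow> ('y::real_normed_vector \<Rightarrow> 'z) \<Rightarrow> 'x set \<Rightarrow> bool" where
  "compact_in iX iY S \<longleftrightarrow> iX ` S \<subseteq> range iY \<and> compact (part_in iX iY S)"

definition precompact_in ::
  "('x \<Rightarrow> 'z) \<Rightarrow> ('y::real_normed_vector \<Rightarrow> 'z) \<Rightarrow> 'x set \<Rightarrow> bool" where
  "precompact_in iX iY S \<longleftrightarrow> iX ` S \<subseteq> range iY \<and> compact (closure (part_in iX iY S))"

text \<open>The norm of the second space is read as \<open>\<infinity>\<close> outside that space. Hence convergence of this
  quantity to \<open>0\<close> includes that the first argument is eventually contained in the second space.\<close>

definition semidist_in ::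
  "('x \<Rightarrow> 'z) \<Rightarrow> ('y::real_normed_vector \<Rightarrow> 'z) \<Rightarrow> 'x set \<Rightarrow> 'x set \<Rightarrow> ennreal" where
  "semidist_in iX iY A B =
     (if iX ` A \<subseteq> range iY then semidist (part_in iX iY A) (part_in iX iY B) else \<infinity>)"

definition pullback_absorbing ::
  "'w measure \<Rightarrow> (real \<Rightarrow> 'w \<Rightarrow> 'w) \<Rightarrow> ('w, 'x) family set \<Rightarrow>
   (real \<Rightarrow> real \<Rightarrow> 'w \<Rightarrow> 'x \<Rightarrow> 'x) \<Rightarrow> ('w, 'x) family \<Rightarrow> bool" where
  "pullback_absorbing M \<theta> \<D> \<phi> K \<longleftrightarrow>
     K \<in> \<D> \<and>
     (\<forall>\<tau>. \<forall>\<omega>\<in>space M. \<forall>B\<in>\<D>. \<exists>T>0. \<forall>t\<ge>T.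
        \<phi> t (\<tau> - t) (\<theta> (- t) \<omega>) ` B (\<tau> - t) (\<theta> (- t) \<omega>) \<subseteq> K \<tau> \<omega>)"

text \<open>The parameters \<open>cpt\<close> and \<open>d\<close> are compactness and the Hausdorff semi-metric of the space in which
  attraction takes place; measurability always refers to the phase space \<open>'x\<close>.\<close>

definition pullback_attractor_wrt ::
  "('x set \<Rightarrow> bool) \<Rightarrow> ('x set \<Rightarrow> 'x set \<Rightarrow> ennreal) \<Rightarrow>
   'w measure \<Rightarrow> (real \<Rightarrow> 'w \<Rightarrow> 'w) \<Rightarrow>
   ('w, 'x::{banach, second_countable_topology}) family set \<Rightarrow>
   (real \<Rightarrow> real \<Rightarrow> 'w \<Rightarrow> 'x \<Rightarrow> 'x) \<Rightarrow> ('w, 'x) family \<Rightarrow> bool" where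
  "pullback_attractor_wrt cpt d M \<theta> \<D> \<phi> A \<longleftrightarrow>
     A \<in> \<D> \<and>
     measurable_family M A \<and>
     (\<forall>\<tau>. \<forall>\<omega>\<in>space M. cpt (A \<tau> \<omega>)) \<and>
     (\<forall>t\<ge>0. \<forall>\<tau>. \<forall>\<omega>\<in>space M. \<phi> t \<tau> \<omega> ` A \<tau> \<omega> = A (\<tau> + t) (\<theta> t \<omega>)) \<and>
     (\<forall>B\<in>\<D>. \<forall>\<tau>. \<forall>\<omega>\<in>space M.
        ((\<lambda>t. d (\<phi> t (\<tau> - t) (\<theta> (- t) \<omega>) ` B (\<tau> - t) (\<theta> (- t) \<omega>)) (A \<tau> \<omega>))
           \<longlongrightarrow> 0) at_top)"

definition pullback_attractor ::
  "'w measure \<Rightarrow> (real \<Rightarrow> 'w \<Rightarrow> 'w) \<Rightarrow>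
   ('w, 'x::{banach, second_countable_topology}) family set \<Rightarrow>
   (real \<Rightarrow> real \<Rightarrow> 'w \<Rightarrow> 'x \<Rightarrow> 'x) \<Rightarrow> ('w, 'x) family \<Rightarrow> bool" where
  "pullback_attractor = pullback_attractor_wrt compact semidist"

definition pullback_attractor_in ::
  "('x \<Rightarrow> 'z) \<Rightarrow> ('y::{banach, second_countable_topology} \<Rightarrow> 'z) \<Rightarrow>
   'w measure \<Rightarrow> (real \<Rightarrow> 'w \<Rightarrow> 'w) \<Rightarrow>
   ('w, 'x::{banach, second_countable_topology}) family set \<Rightarrow>
   (real \<Rightarrow> real \<Rightarrow> 'w \<Rightarrow> 'x \<Rightarrow> 'x) \<Rightarrow> ('w, 'x) family \<Rightarrow> bool" where
  "pullback_attractor_in iX iY =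
     pullback_attractor_wrt (compact_in iX iY) (semidist_in iX iY)"

end

theory Submission
  imports Defs
begin

text \<open>
  Everything rests on one closedness property: if \<open>\<epsilon>\<^sub>n \<rightarrow> \<epsilon>\<^sub>0\<close>, \<open>x\<^sub>n \<in> A\<^bsub>\<epsilon>\<^sub>n\<^esub>(\<tau>, \<omega>)\<close> and \<open>x\<^sub>n \<rightarrow> x\<close> in
  \<open>X\<close>, then \<open>x \<in> A\<^bsub>\<epsilon>\<^sub>0\<^esub>(\<tau>, \<omega>)\<close>. By invariance, for each \<open>t \<ge> 0\<close> the points \<open>x\<^sub>n\<close> are images under the
  time-\<open>t\<close> cocycle of points \<open>z\<^sub>n\<close> of the attractors at \<open>(\<tau> - t, \<theta>\<^bsub>-t\<^esub>\<omega>)\<close>. These have a convergent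
  subsequence, whose limit \<open>z\<close> lies in the ball \<open>B\<^sub>0\<close> because the attractors lie in the absorbing
  sets, and \<open>x\<close> is the image of \<open>z\<close> under the limiting cocycle. So \<open>x\<close> lies in the image of \<open>B\<^sub>0\<close> for
  every pullback time \<open>t\<close>, and \<open>B\<^sub>0\<close> is attracted by \<open>A\<^bsub>\<epsilon>\<^sub>0\<^esub>\<close>. Both convergence claims follow by
  contradiction, extracting convergent subsequences by precompactness; in \<open>Y\<close> the limit is
  identified through its limit in \<open>X\<close>.
\<close>

section \<open>Subsequences and the Hausdorff semi-distance\<close>

lemma compact_closure_subsequence:
  fixes u :: "nat \<Rightarrow> 'v::metric_space"
  assumes "compact (closure S)" and "\<And>n. u n \<in> S"
  obtains l r where "strict_mono (r :: nat \<Rightarrow> nat)" "(\<lambda>n. u (r n)) \<longlonglongrightarrow> l"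
proof -
  have "\<forall>n. u n \<in> closure S"
    using assms(2) closure_subset by blast
  then obtain l r where "strict_mono (r :: nat \<Rightarrow> nat)" "(u \<circ> r) \<longlonglongrightarrow> l"
    using assms(1)[unfolded compact_def, rule_format, of u] by blast
  then show thesis
    using that[of r l] by (simp add: o_def)
qed

text \<open>In \<open>ennreal\<close> the infimum over the empty set is \<infinity>, so a zero
  infimum also guarantees points of \<open>S\<close> arbitrarily close to \<open>x\<close>.\<close>

lemma INF_norm_eq_0_imp_mem:
  fixes S :: "'v::real_normed_vector set"
  assumes "closed S" and zero: "(INF b\<in>S. ennreal (norm (x - b))) = 0"
  shows "x \<in> S"
proof -
  have "\<exists>y\<in>S. dist y x < e" if "e > 0" for e
  proof -
    have "(INF b\<in>S. ennreal (norm (x - b))) < ennreal e"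
      using that zero by simp
    then obtain b where "b \<in> S" "ennreal (norm (x - b)) < ennreal e"
      by (auto simp: INF_less_iff)
    then show ?thesis
      by (intro bexI[of _ b]) (auto simp: dist_norm norm_minus_commute ennreal_less_iff)
  qed
  then show ?thesis
    using closed_approachable[OF \<open>closed S\<close>, of x] by blast
qed

text \<open>Without convergence there are points \<open>u n\<close> of \<open>S (e n)\<close>
  staying at least \<open>c\<close> away from \<open>T\<close>, while precompactness and
  \<open>lim\<close> produce a subsequential limit inside \<open>T\<close>. The value type is
  generic so that the criterion serves both Banach spaces.\<close>

lemma semidist_tendsto_0I:
  fixes S :: "real \<Rightarrow> 'v::real_normed_vector set"
  assumes cpt: "compact (closure (\<Union>\<epsilon>\<in>I. S \<epsilon>))"
    and lim: "\<And>e u l. \<lbrakk>\<And>n. e n \<in> I; filterlim e (at \<epsilon>0 within I) sequentially;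
                \<And>n. u n \<in> S (e n); u \<longlonglongrightarrow> l\<rbrakk> \<Longrightarrow> l \<in> T"
  shows "((\<lambda>\<epsilon>. semidist (S \<epsilon>) T) \<longlongrightarrow> 0) (at \<epsilon>0 within I)"
proof (rule ccontr)
  assume "\<not> ?thesis"
  then obtain d where d: "d > 0"
    and nev: "\<not> (\<forall>\<^sub>F \<epsilon> in at \<epsilon>0 within I. semidist (S \<epsilon>) T < d)"
    unfolding order_tendsto_iff by auto
  \<comment> \<open>\<open>d\<close> may be \<infinity>; a real bound strictly below it can be
    compared with norms and also singles out a point in the supremum defining
    \<open>semidist\<close>.\<close>
  obtain c where c: "c > 0" "ennreal c < d"
  proof -
    obtain c' where c': "0 < c'" "c' < d"
      using d dense by blast
    then obtain c where "c' = ennreal c" "c \<ge> 0"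
      by (cases c') auto
    with c' that[of c] show thesis
      by simp
  qed
  have "\<exists>\<epsilon> u. \<epsilon> \<in> I \<and> \<epsilon> \<noteq> \<epsilon>0 \<and> dist \<epsilon> \<epsilon>0 < inverse (real (Suc n)) \<and> u \<in> S \<epsilon> \<and>
          ennreal c \<le> (INF b\<in>T. ennreal (norm (u - b)))" for n
  proof -
    obtain \<epsilon> where \<epsilon>: "\<epsilon> \<in> I" "\<epsilon> \<noteq> \<epsilon>0" "dist \<epsilon> \<epsilon>0 < inverse (real (Suc n))" "d \<le> semidist (S \<epsilon>) T"
      using nev[unfolded eventually_at, simplified, rule_format, of "inverse (real (Suc n))"]
      by (auto simp: not_less)
    then have "ennreal c < semidist (S \<epsilon>) T"
      using c by order
    then obtain u where "u \<in> S \<epsilon>" "ennreal c < (INF b\<in>T. ennreal (norm (u - b)))"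
      unfolding semidist_def less_SUP_iff by auto
    with \<epsilon> show ?thesis
      using less_imp_le by blast
  qed
  then obtain e u where e: "\<And>n. e n \<in> I" "\<And>n. e n \<noteq> \<epsilon>0"
      and dist_e: "\<And>n. dist (e n) \<epsilon>0 < inverse (real (Suc n))"
      and u: "\<And>n. u n \<in> S (e n)" "\<And>n. ennreal c \<le> (INF b\<in>T. ennreal (norm (u n - b)))"
    by metis
  have "e \<longlonglongrightarrow> \<epsilon>0"
    using dist_e by (intro metric_tendsto_imp_tendsto[OF LIMSEQ_inverse_real_of_nat]
        always_eventually) (auto intro: less_imp_le)
  \<comment> \<open>The filter is punctured, so \<open>e n \<noteq> \<epsilon>0\<close> is needed on
    top of convergence.\<close>
  then have elim: "filterlim e (at \<epsilon>0 within I) sequentially"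
    using e by (simp add: filterlim_at)
  have "u n \<in> (\<Union>\<epsilon>\<in>I. S \<epsilon>)" for n
    using e u by blast
  then obtain l r where r: "strict_mono r" and l: "(\<lambda>n. u (r n)) \<longlonglongrightarrow> l"
    using compact_closure_subsequence[OF cpt] by metis
  have "l \<in> T"
    using lim[of "\<lambda>n. e (r n)" "\<lambda>n. u (r n)" l] e u l
      filterlim_compose[OF elim filterlim_subseq[OF r]] by blast
  have "\<forall>\<^sub>F n in sequentially. dist (u (r n)) l < c"
    using l \<open>c > 0\<close> tendstoD by blast
  then obtain n where "dist (u (r n)) l < c"
    using eventually_happens by force
  then have "ennreal (norm (u (r n) - l)) < ennreal c"
    using \<open>c > 0\<close> by (simp add: dist_norm ennreal_less_iff)
  moreover have "(INF b\<in>T. ennreal (norm (u (r n) - b))) \<le> ennreal (norm (u (r n) - l))"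
    using \<open>l \<in> T\<close> by (rule INF_lower)
  ultimately show False
    using u(2)[of "r n"] by order
qed

section \<open>Pullback dynamics on attractors and absorbing sets\<close>

lemma measurable_dynamical_system_space:
  assumes "measurable_dynamical_system M \<theta>" "\<omega> \<in> space M"
  shows "\<theta> t \<omega> \<in> space M"
proof -
  have "(\<lambda>(t, \<omega>). \<theta> t \<omega>) \<in> borel \<Otimes>\<^sub>M M \<rightarrow>\<^sub>M M"
    using assms(1) by (simp add: measurable_dynamical_system_def)
  then show ?thesis
    using measurable_space[of "\<lambda>(t, \<omega>). \<theta> t \<omega>" "borel \<Otimes>\<^sub>M M" M "(t, \<omega>)"] assms(2)
    by (simp add: space_pair_measure)
qed

lemma measurable_dynamical_system_inverse:
  assumes "measurable_dynamical_system M \<theta>" "\<omega> \<in> space M"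
  shows "\<theta> t (\<theta> (- t) \<omega>) = \<omega>"
  using assms unfolding measurable_dynamical_system_def by (metis add.right_inverse)

lemma pullback_attractor_pullback_invariant:
  assumes mds: "measurable_dynamical_system M \<theta>" and "pullback_attractor M \<theta> \<D> \<phi> A"
    and "t \<ge> 0" "\<omega> \<in> space M"
  shows "\<phi> t (\<tau> - t) (\<theta> (- t) \<omega>) ` A (\<tau> - t) (\<theta> (- t) \<omega>) = A \<tau> \<omega>"
proof -
  have "\<phi> t (\<tau> - t) (\<theta> (- t) \<omega>) ` A (\<tau> - t) (\<theta> (- t) \<omega>)
        = A (\<tau> - t + t) (\<theta> t (\<theta> (- t) \<omega>))"
    using assms measurable_dynamical_system_space[OF mds \<open>\<omega> \<in> space M\<close>]
    unfolding pullback_attractor_def pullback_attractor_wrt_def by blast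
  then show ?thesis
    by (simp add: measurable_dynamical_system_inverse[OF mds \<open>\<omega> \<in> space M\<close>])
qed

text \<open>The attractor is itself a member of \<open>\<D>\<close>, so \<open>K\<close> absorbs it,
  and by invariance its pullback image is the attractor again.\<close>

lemma pullback_attractor_subset_absorbing:
  assumes "measurable_dynamical_system M \<theta>" and att: "pullback_attractor M \<theta> \<D> \<phi> A"
    and absorb: "pullback_absorbing M \<theta> \<D> \<phi> K" and "\<omega> \<in> space M"
  shows "A \<tau> \<omega> \<subseteq> K \<tau> \<omega>"
proof -
  have "A \<in> \<D>"
    using att by (simp add: pullback_attractor_def pullback_attractor_wrt_def)
  then obtain t where "t > 0" "\<phi> t (\<tau> - t) (\<theta> (- t) \<omega>) ` A (\<tau> - t) (\<theta> (- t) \<omega>) \<subseteq> K \<tau> \<omega>"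
    using absorb \<open>\<omega> \<in> space M\<close> unfolding pullback_absorbing_def by (meson order_refl)
  then show ?thesis
    using pullback_attractor_pullback_invariant[OF assms(1,2) _ assms(4), of t \<tau>] by simp
qed

text \<open>For every slack \<open>\<delta>\<close>, the bound \<rho> + \<delta> eventually holds
  for whole sets along \<open>e\<close>, hence for the points \<open>u n\<close>, and passes to
  their limit. This places limits of points of absorbing sets in the ball
  \<open>B\<^sub>0\<close>.\<close>

lemma norm_limit_le_Limsup_set_norm:
  fixes S :: "'a \<Rightarrow> 'v::real_normed_vector set"
  assumes "Limsup F (\<lambda>\<epsilon>. set_norm (S \<epsilon>)) \<le> ennreal \<rho>" and "\<rho> \<ge> 0"
    and e: "filterlim e F sequentially" and u: "\<And>n. u n \<in> S (e n)" "u \<longlonglongrightarrow> l"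
  shows "norm l \<le> \<rho>"
proof (rule field_le_epsilon)
  fix \<delta> :: real
  assume "\<delta> > 0"
  with assms(1,2) have "Limsup F (\<lambda>\<epsilon>. set_norm (S \<epsilon>)) < ennreal (\<rho> + \<delta>)"
    by (simp add: ennreal_lessI order.strict_trans1)
  then have "\<forall>\<^sub>F \<epsilon> in F. set_norm (S \<epsilon>) < ennreal (\<rho> + \<delta>)"
    by (rule Limsup_lessD)
  then have "\<forall>\<^sub>F n in sequentially. set_norm (S (e n)) < ennreal (\<rho> + \<delta>)"
    using e unfolding filterlim_iff by blast
  then have "\<forall>\<^sub>F n in sequentially. norm (u n) \<le> \<rho> + \<delta>"
  proof eventually_elim
    case (elim n)
    have "ennreal (norm (u n)) \<le> set_norm (S (e n))"
      unfolding set_norm_def by (rule SUP_upper[OF u(1)])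
    also note elim
    finally show ?case
      by (simp add: ennreal_less_iff)
  qed
  then show "norm l \<le> \<rho> + \<delta>"
    using tendsto_upperbound[OF tendsto_norm[OF u(2)]] by simp
qed

text \<open>The distance from \<open>x\<close> to the attractor does not depend on \<open>t\<close>,
  yet is bounded by a semi-distance tending to 0; compact sets being closed, \<open>x\<close>
  belongs to the attractor.\<close>

lemma pullback_attractor_memI:
  assumes att: "pullback_attractor M \<theta> \<D> \<phi> A" and "B \<in> \<D>" and "\<omega> \<in> space M"
    and x: "\<And>t. t \<ge> 0 \<Longrightarrow> x \<in> \<phi> t (\<tau> - t) (\<theta> (- t) \<omega>) ` B (\<tau> - t) (\<theta> (- t) \<omega>)"
  shows "x \<in> A \<tau> \<omega>"
proof -
  let ?img = "\<lambda>t. \<phi> t (\<tau> - t) (\<theta> (- t) \<omega>) ` B (\<tau> - t) (\<theta> (- t) \<omega>)"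
  have tends: "((\<lambda>t. semidist (?img t) (A \<tau> \<omega>)) \<longlongrightarrow> 0) at_top" and cpt: "compact (A \<tau> \<omega>)"
    using att \<open>B \<in> \<D>\<close> \<open>\<omega> \<in> space M\<close>
    unfolding pullback_attractor_def pullback_attractor_wrt_def by auto
  have "\<forall>\<^sub>F t in at_top. (INF b\<in>A \<tau> \<omega>. ennreal (norm (x - b))) \<le> semidist (?img t) (A \<tau> \<omega>)"
    using eventually_ge_at_top[of 0]
  proof eventually_elim
    case (elim t)
    show ?case
      unfolding semidist_def by (rule SUP_upper[OF x[OF elim]])
  qed
  then have "(INF b\<in>A \<tau> \<omega>. ennreal (norm (x - b))) \<le> 0"
    using tendsto_lowerbound[OF tends] by simp
  then show ?thesis
    using INF_norm_eq_0_imp_mem compact_imp_closed[OF cpt] by simp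
qed

section \<open>Upper semicontinuity in both spaces\<close>

lemma part_in_UN: "part_in iX iY (\<Union>\<epsilon>\<in>I. S \<epsilon>) = (\<Union>\<epsilon>\<in>I. part_in iX iY (S \<epsilon>))"
  by (auto simp: part_in_def)

theorem theorem2p7:
  fixes iX :: "'x::{banach, second_countable_topology} \<Rightarrow> 'z"
    and iY :: "'y::{banach, second_countable_topology} \<Rightarrow> 'z"
    and M :: "'w measure"
    and \<theta> :: "real \<Rightarrow> 'w \<Rightarrow> 'w"
    and I :: "real set"
    and \<epsilon>0 :: real
    and \<D> :: "real \<Rightarrow> ('w, 'x) family set"
    and \<phi> :: "real \<Rightarrow> real \<Rightarrow> real \<Rightarrow> 'w \<Rightarrow> 'x \<Rightarrow> 'x"
    and R :: "real \<Rightarrow> 'w \<Rightarrow> real"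
    and A K :: "real \<Rightarrow> ('w, 'x) family"
  assumes iX: "inj iX" and iY: "inj iY" and XY: "range iX \<inter> range iY \<noteq> {}"
    and mds: "measurable_dynamical_system M \<theta>"
    and \<epsilon>0: "\<epsilon>0 \<in> I"
    and D: "\<And>\<epsilon>. \<epsilon> \<in> I \<Longrightarrow> family_collection M (\<D> \<epsilon>)"
    and cocycle: "\<And>\<epsilon>. \<epsilon> \<in> I \<Longrightarrow> continuous_cocycle M \<theta> (\<phi> \<epsilon>)"
    and C1: "\<And>t \<tau> \<omega> (e :: nat \<Rightarrow> real) (xs :: nat \<Rightarrow> 'x) x.
       t \<ge> 0 \<Longrightarrow> \<omega> \<in> space M \<Longrightarrow> (\<And>n. e n \<in> I) \<Longrightarrow> e \<longlonglongrightarrow> \<epsilon>0 \<Longrightarrow> xs \<longlonglongrightarrow> x \<Longrightarrow>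
       (\<lambda>n. \<phi> (e n) t (\<tau> - t) (\<theta> (- t) \<omega>) (xs n)) \<longlonglongrightarrow> \<phi> \<epsilon>0 t (\<tau> - t) (\<theta> (- t) \<omega>) x"
    and R: "\<And>\<tau> \<omega>. \<omega> \<in> space M \<Longrightarrow> R \<tau> \<omega> \<ge> 0"
    and C2: "(\<lambda>\<tau>. \<lambda>\<omega>\<in>space M. {x. norm x \<le> R \<tau> \<omega>}) \<in> \<D> \<epsilon>0"
    and C3_attractor_X: "\<And>\<epsilon>. \<epsilon> \<in> I \<Longrightarrow> pullback_attractor M \<theta> (\<D> \<epsilon>) (\<phi> \<epsilon>) (A \<epsilon>)"
    and C3_attractor_Y: "\<And>\<epsilon>. \<epsilon> \<in> I \<Longrightarrow> pullback_attractor_in iX iY M \<theta> (\<D> \<epsilon>) (\<phi> \<epsilon>) (A \<epsilon>)"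
    and C3_absorbing: "\<And>\<epsilon>. \<epsilon> \<in> I \<Longrightarrow>
       closed_family M (K \<epsilon>) \<and> measurable_family M (K \<epsilon>) \<and>
       pullback_absorbing M \<theta> (\<D> \<epsilon>) (\<phi> \<epsilon>) (K \<epsilon>)"
    and C3_limsup: "\<And>\<tau> \<omega>. \<omega> \<in> space M \<Longrightarrow>
       Limsup (at \<epsilon>0 within I) (\<lambda>\<epsilon>. set_norm (K \<epsilon> \<tau> \<omega>)) \<le> ennreal (R \<tau> \<omega>)"
    and C4: "\<And>\<tau> \<omega>. \<omega> \<in> space M \<Longrightarrow> compact (closure (\<Union>\<epsilon>\<in>I. A \<epsilon> \<tau> \<omega>))"
  shows
    "(\<forall>\<tau>. \<forall>\<omega>\<in>space M.
        ((\<lambda>\<epsilon>. semidist (A \<epsilon> \<tau> \<omega>) (A \<epsilon>0 \<tau> \<omega>)) \<longlongrightarrow> 0) (at \<epsilon>0 within I))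
     \<and>
     ((\<forall>\<tau>. \<forall>\<omega>\<in>space M. precompact_in iX iY (\<Union>\<epsilon>\<in>I. A \<epsilon> \<tau> \<omega>)) \<longrightarrow>
      (\<forall>\<epsilon>\<in>I. \<forall>t>0. \<forall>\<tau>. \<forall>\<omega>\<in>space M. \<forall>x. iX (\<phi> \<epsilon> t \<tau> \<omega> x) \<in> range iX \<inter> range iY) \<longrightarrow>
      (\<forall>(xs :: nat \<Rightarrow> 'x) (ys :: nat \<Rightarrow> 'y) x y.
         (\<forall>n. iX (xs n) = iY (ys n)) \<and> xs \<longlonglongrightarrow> x \<and> ys \<longlonglongrightarrow> y \<longrightarrow> iX x = iY y) \<longrightarrow>
      (\<forall>\<tau>. \<forall>\<omega>\<in>space M.
        ((\<lambda>\<epsilon>. semidist_in iX iY (A \<epsilon> \<tau> \<omega>) (A \<epsilon>0 \<tau> \<omega>)) \<longlongrightarrow> 0) (at \<epsilon>0 within I)))"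
proof -
  have closed: "x \<in> A \<epsilon>0 \<tau> \<omega>"
    if \<omega>: "\<omega> \<in> space M" and e: "\<And>n. e n \<in> I"
      and elim: "filterlim e (at \<epsilon>0 within I) sequentially"
      and xs: "\<And>n. xs n \<in> A (e n) \<tau> \<omega>" "xs \<longlonglongrightarrow> x"
    for \<tau> \<omega> e x and xs :: "nat \<Rightarrow> 'x"
  proof (rule pullback_attractor_memI[OF C3_attractor_X[OF \<epsilon>0] C2 \<omega>])
    fix t :: real
    assume t: "t \<ge> 0"
    define \<omega>' where "\<omega>' = \<theta> (- t) \<omega>"
    have \<omega>': "\<omega>' \<in> space M"
      unfolding \<omega>'_def by (rule measurable_dynamical_system_space[OF mds \<omega>])
    have "xs n \<in> \<phi> (e n) t (\<tau> - t) \<omega>' ` A (e n) (\<tau> - t) \<omega>'" for n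
      using xs(1)[of n] unfolding \<omega>'_def
      by (simp add: pullback_attractor_pullback_invariant[OF mds C3_attractor_X[OF e] t \<omega>])
    then have "\<forall>n. \<exists>z. z \<in> A (e n) (\<tau> - t) \<omega>' \<and> \<phi> (e n) t (\<tau> - t) \<omega>' z = xs n"
      by (simp add: image_iff Bex_def eq_commute)
    then obtain zs where zs: "\<And>n. zs n \<in> A (e n) (\<tau> - t) \<omega>'"
        "\<And>n. \<phi> (e n) t (\<tau> - t) \<omega>' (zs n) = xs n"
      by metis
    have "zs n \<in> (\<Union>\<epsilon>\<in>I. A \<epsilon> (\<tau> - t) \<omega>')" for n
      using zs(1) e by blast
    \<comment> \<open>\<open>C4\<close> is applied at the earlier fibre (\<open>\<tau> - t\<close>,
      \<open>\<omega>'\<close>), where the preimages live.\<close>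
    then obtain z r where r: "strict_mono r" and z: "(\<lambda>n. zs (r n)) \<longlonglongrightarrow> z"
      using compact_closure_subsequence[OF C4[OF \<omega>']] by metis
    have er: "filterlim (\<lambda>n. e (r n)) (at \<epsilon>0 within I) sequentially"
      by (rule filterlim_compose[OF elim filterlim_subseq[OF r]])
    \<comment> \<open>\<open>C1\<close> asks for plain convergence; the punctured form
      \<open>er\<close> is kept for the \<open>Limsup\<close> in \<open>C3_limsup\<close>.\<close>
    then have "(\<lambda>n. e (r n)) \<longlonglongrightarrow> \<epsilon>0"
      by (simp add: filterlim_at)
    then have "(\<lambda>n. \<phi> (e (r n)) t (\<tau> - t) \<omega>' (zs (r n))) \<longlonglongrightarrow> \<phi> \<epsilon>0 t (\<tau> - t) \<omega>' z"
      unfolding \<omega>'_def by (rule C1[OF t \<omega> e _ z])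
    then have "(\<lambda>n. xs (r n)) \<longlonglongrightarrow> \<phi> \<epsilon>0 t (\<tau> - t) \<omega>' z"
      by (simp add: zs(2))
    \<comment> \<open>The same subsequence also converges to \<open>x\<close>.\<close>
    then have x_eq: "x = \<phi> \<epsilon>0 t (\<tau> - t) \<omega>' z"
      using LIMSEQ_subseq_LIMSEQ[OF xs(2) r] LIMSEQ_unique by (auto simp: o_def)
    have "zs (r n) \<in> K (e (r n)) (\<tau> - t) \<omega>'" for n
      using pullback_attractor_subset_absorbing[OF mds C3_attractor_X[OF e] _ \<omega>']
        C3_absorbing[OF e] zs(1) by blast
    then have "norm z \<le> R (\<tau> - t) \<omega>'"
      using norm_limit_le_Limsup_set_norm[OF C3_limsup[OF \<omega>'] R[OF \<omega>'] er _ z] by blast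
    \<comment> \<open>The radius just obtained is that of \<open>B\<^sub>0\<close> at this fibre,
      and \<open>\<omega>'\<close> in \<open>space M\<close> lets the restricted abstraction be
      evaluated.\<close>
    then show "x \<in> \<phi> \<epsilon>0 t (\<tau> - t) (\<theta> (- t) \<omega>) `
        (\<lambda>\<omega>\<in>space M. {x. norm x \<le> R (\<tau> - t) \<omega>}) (\<theta> (- t) \<omega>)"
      using x_eq \<omega>' unfolding \<omega>'_def by simp
  qed
  show ?thesis
  proof (intro conjI impI allI ballI)
    fix \<tau> \<omega>
    assume \<omega>: "\<omega> \<in> space M"
    show "((\<lambda>\<epsilon>. semidist (A \<epsilon> \<tau> \<omega>) (A \<epsilon>0 \<tau> \<omega>)) \<longlongrightarrow> 0) (at \<epsilon>0 within I)"
      by (rule semidist_tendsto_0I[OF C4[OF \<omega>] closed[OF \<omega>]])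
  next
    fix \<tau> \<omega>
    assume C5: "\<forall>\<tau>. \<forall>\<omega>\<in>space M. precompact_in iX iY (\<Union>\<epsilon>\<in>I. A \<epsilon> \<tau> \<omega>)"
      and compat: "\<forall>(xs :: nat \<Rightarrow> 'x) (ys :: nat \<Rightarrow> 'y) x y.
         (\<forall>n. iX (xs n) = iY (ys n)) \<and> xs \<longlonglongrightarrow> x \<and> ys \<longlonglongrightarrow> y \<longrightarrow> iX x = iY y"
      and \<omega>: "\<omega> \<in> space M"
    have sub: "iX ` A \<epsilon> \<tau> \<omega> \<subseteq> range iY" if "\<epsilon> \<in> I" for \<epsilon>
      using C5 \<omega> that unfolding precompact_in_def by blast
    have cpt: "compact (closure (\<Union>\<epsilon>\<in>I. part_in iX iY (A \<epsilon> \<tau> \<omega>)))"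
      using C5 \<omega> unfolding precompact_in_def part_in_UN by blast
    have "((\<lambda>\<epsilon>. semidist (part_in iX iY (A \<epsilon> \<tau> \<omega>)) (part_in iX iY (A \<epsilon>0 \<tau> \<omega>))) \<longlongrightarrow> 0)
            (at \<epsilon>0 within I)"
    proof (rule semidist_tendsto_0I[OF cpt])
      fix e :: "nat \<Rightarrow> real" and ys y
      assume e: "\<And>n. e n \<in> I" and elim: "filterlim e (at \<epsilon>0 within I) sequentially"
        and ys: "\<And>n. ys n \<in> part_in iX iY (A (e n) \<tau> \<omega>)" "ys \<longlonglongrightarrow> y"
      \<comment> \<open>Each \<open>ys n\<close> is represented by a point of the first space, where
        \<open>C4\<close> and \<open>closed\<close> apply.\<close>
      have "\<exists>x. x \<in> A (e n) \<tau> \<omega> \<and> iX x = iY (ys n)" for n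
        using ys(1)[of n] unfolding part_in_def by force
      then obtain xs where xs: "\<And>n. xs n \<in> A (e n) \<tau> \<omega>" "\<And>n. iX (xs n) = iY (ys n)"
        by metis
      have "xs n \<in> (\<Union>\<epsilon>\<in>I. A \<epsilon> \<tau> \<omega>)" for n
        using xs(1) e by blast
      then obtain x r where r: "strict_mono r" and x: "(\<lambda>n. xs (r n)) \<longlonglongrightarrow> x"
        using compact_closure_subsequence[OF C4[OF \<omega>]] by metis
      have "(\<lambda>n. ys (r n)) \<longlonglongrightarrow> y"
        using LIMSEQ_subseq_LIMSEQ[OF ys(2) r] by (simp add: o_def)
      \<comment> \<open>Along \<open>r\<close> the same points converge to \<open>x\<close> in one
        norm and to \<open>y\<close> in the other, so \<open>compat\<close> identifies the
        limits.\<close>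
      then have "iX x = iY y"
        using compat[rule_format, of "\<lambda>n. xs (r n)" "\<lambda>n. ys (r n)" x y] xs(2) x by simp
      moreover have "x \<in> A \<epsilon>0 \<tau> \<omega>"
        by (rule closed[OF \<omega> e filterlim_compose[OF elim filterlim_subseq[OF r]] xs(1) x])
      ultimately show "y \<in> part_in iX iY (A \<epsilon>0 \<tau> \<omega>)"
        unfolding part_in_def by (metis imageI vimageI)
    qed
    \<comment> \<open>The filter only sees parameters in \<open>I\<close>, for which
      \<open>sub\<close> rules out the value \<infinity> assigned outside the second space.\<close>
    moreover have "\<forall>\<^sub>F \<epsilon> in at \<epsilon>0 within I.
        semidist (part_in iX iY (A \<epsilon> \<tau> \<omega>)) (part_in iX iY (A \<epsilon>0 \<tau> \<omega>)) =
        semidist_in iX iY (A \<epsilon> \<tau> \<omega>) (A \<epsilon>0 \<tau> \<omega>)"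
      unfolding eventually_at_filter by (auto simp: semidist_in_def sub)
    ultimately show "((\<lambda>\<epsilon>. semidist_in iX iY (A \<epsilon> \<tau> \<omega>) (A \<epsilon>0 \<tau> \<omega>)) \<longlongrightarrow> 0) (at \<epsilon>0 within I)"
      by (rule Lim_transform_eventually)
  qed
qed

end
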